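(* Every finite simple $3$-connected non-bipartite graph $G$ with minimum degree at least four contains two cycles with consecutive odd lengths, i.e. there is an odd integer $\ell$ such that $G$ contains a cycle of length $\ell$ and a cycle of length $\ell+2$.
   Context: All graphs are finite, simple and undirected. The length of a cycle is its number of edges. *)

theory Defs
  imports "Graph_Theory.Graph_Theory"
begin

text \<open>
  A finite simple undirected graph is represented, as in the library, by a finite loop-free digraph
  with symmetric arc relation (locale \<^locale>\<open>pair_graph\<close>): an undirected edge \<open>uv\<close> is the pair of
  arcs \<open>(u,v)\<close> and \<open>(v,u)\<close>. Hence the degree of a vertex is its out-degree.
\<close>

definition min_degree :: "('a, 'b) pre_digraph \<Rightarrow> nat" where
  "min_degree G = Min (out_degree G ` verts G)"

definition bipartite_graph :: "('a, 'b) pre_digraph \<Rightarrow> bool" where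
  "bipartite_graph G \<longleftrightarrow>
     (\<exists>A B. A \<union> B = verts G \<and> A \<inter> B = {} \<and>
        (\<forall>(u, v) \<in> arcs_ends G. (u \<in> A \<and> v \<in> B) \<or> (u \<in> B \<and> v \<in> A)))"

definition vertex_connected :: "nat \<Rightarrow> ('a, 'b) pre_digraph \<Rightarrow> bool" where
  "vertex_connected k G \<longleftrightarrow>
     k < card (verts G) \<and>
     (\<forall>S \<subseteq> verts G. card S < k \<longrightarrow> Digraph_Component.connected (G \<restriction> (verts G - S)))"

text \<open>
  In the symmetric representation \<^const>\<open>pre_digraph.cycle\<close> also admits the closed walk of length
  2 that traverses one edge in both directions, so the length bound 3 is imposed explicitly.
\<close>

definition has_cycle_of_length :: "('a, 'b) pre_digraph \<Rightarrow> nat \<Rightarrow> bool" where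
  "has_cycle_of_length G n \<longleftrightarrow> 3 \<le> n \<and> (\<exists>p. pre_digraph.cycle G p \<and> length p = n)"

end

theory Submission
  imports Defs
begin

text \<open>
  Let \<open>C\<close> be a shortest odd cycle and \<open>L\<close> a component of \<open>G - C\<close>. Any two vertices of \<open>C\<close> are joined
  inside \<open>C\<close> by paths of both parities, so it suffices to find \<open>v, v'\<close> on \<open>C\<close> and two \<open>v'\<close>--\<open>v\<close> paths
  through \<open>L\<close> whose lengths differ by two and which start with the same edge. These come from a lemma on
  graphs with two roots \<open>c, b\<close> that become 2-connected when the edge \<open>cb\<close> is added and in which every
  other vertex has degree at least four: some neighbour \<open>x\<close> of \<open>c\<close> has two paths to \<open>b\<close> avoiding \<open>c\<close> of
  lengths differing by two. The lemma is proved by induction, contracting the neighbourhood of \<open>b\<close>.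
  Degrees survive the contraction unless some \<open>z\<close> has two neighbours next to \<open>b\<close>, and then the resulting
  4-cycle through \<open>b\<close> provides a detour of length two.

  To apply the lemma with \<open>b = v\<close> and \<open>c\<close> the contraction of \<open>C - v\<close>, no vertex of \<open>L\<close> may have two
  neighbours in \<open>C - v\<close>. If \<open>C\<close> has length at least five, two neighbours of a vertex on \<open>C\<close> are at
  distance two by minimality, and either the two routes around them already give the cycles or \<open>L\<close> is
  attached to just three consecutive vertices of \<open>C\<close>. If \<open>C\<close> is a triangle, a suitable \<open>v\<close> exists
  unless there is a cycle of length five or a \<open>K\<^sub>4\<close>; in the latter case \<open>K\<^sub>4\<close> takes the role of \<open>C\<close>.
\<close>

section \<open>Paths, boundaries and connected vertex sets\<close>

definition upath :: "('a \<Rightarrow> 'a \<Rightarrow> bool) \<Rightarrow> 'a set \<Rightarrow> 'a \<Rightarrow> 'a \<Rightarrow> 'a list \<Rightarrow> bool" where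
  "upath E S x y p \<longleftrightarrow>
     p \<noteq> [] \<and> hd p = x \<and> last p = y \<and> distinct p \<and> set p \<subseteq> S \<and> successively E p"

definition two_paths :: "('a \<Rightarrow> 'a \<Rightarrow> bool) \<Rightarrow> 'a set \<Rightarrow> 'a \<Rightarrow> 'a \<Rightarrow> bool" where
  "two_paths E S x y \<longleftrightarrow>
     (\<exists>p q. upath E S x y p \<and> upath E S x y q \<and> length q = length p + 2)"

definition boundary :: "'a set \<Rightarrow> ('a \<Rightarrow> 'a \<Rightarrow> bool) \<Rightarrow> 'a set \<Rightarrow> 'a set" where
  "boundary V E K = {v \<in> V - K. \<exists>k\<in>K. E k v}"

text \<open>The closure is reflexive at every vertex, even outside \<open>S\<close>, so membership
  of the starting vertex in \<open>S\<close> is asked for separately where it matters.\<close>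

definition linked :: "('a \<Rightarrow> 'a \<Rightarrow> bool) \<Rightarrow> 'a set \<Rightarrow> 'a \<Rightarrow> 'a \<Rightarrow> bool" where
  "linked E S = (\<lambda>u v. u \<in> S \<and> v \<in> S \<and> E u v)\<^sup>*\<^sup>*"

definition conn :: "('a \<Rightarrow> 'a \<Rightarrow> bool) \<Rightarrow> 'a set \<Rightarrow> bool" where
  "conn E K \<longleftrightarrow> (\<forall>x\<in>K. \<forall>y\<in>K. linked E K x y)"

definition component_of :: "('a \<Rightarrow> 'a \<Rightarrow> bool) \<Rightarrow> 'a set \<Rightarrow> 'a \<Rightarrow> 'a set" where
  "component_of E S x = {v \<in> S. linked E S x v}"

lemma upath_mono: "upath E S x y p \<Longrightarrow> S \<subseteq> T \<Longrightarrow> upath E T x y p"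
  by (auto simp: upath_def)

lemma upath_hd_in: "upath E S x y p \<Longrightarrow> x \<in> S"
  unfolding upath_def by (metis hd_in_set subsetD)

lemma two_paths_mono: "two_paths E S x y \<Longrightarrow> S \<subseteq> T \<Longrightarrow> two_paths E T x y"
  unfolding two_paths_def by (meson upath_mono)

lemma upath_append:
  assumes "upath E S x z p" "upath E T w y q" "E z w" "S \<inter> T = {}"
  shows "upath E (S \<union> T) x y (p @ q)"
  using assms by (auto simp: upath_def successively_append_iff)

lemma upath_singleton [simp]: "upath E S x y [z] \<longleftrightarrow> z = x \<and> z = y \<and> z \<in> S"
  by (auto simp: upath_def)

lemma upath_rev:
  assumes "symp E" "upath E S x y p"
  shows "upath E S y x (rev p)"
proof -
  have "successively (\<lambda>x y. E y x) p"
    using assms by (auto simp: upath_def elim!: successively_mono dest: sympD)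
  then show ?thesis
    using assms by (auto simp: upath_def hd_rev last_rev)
qed

text \<open>Both paths receive the same prefix, so the difference of their lengths is
  preserved.\<close>

lemma two_paths_prepend:
  assumes "upath E S x z p" "two_paths E T w y" "E z w" "S \<inter> T = {}"
  shows "two_paths E (S \<union> T) x y"
proof -
  obtain q q' where q: "upath E T w y q" "upath E T w y q'" "length q' = length q + 2"
    using assms(2) by (auto simp: two_paths_def)
  show ?thesis
    unfolding two_paths_def
    using upath_append[OF assms(1) q(1) assms(3,4)] upath_append[OF assms(1) q(2) assms(3,4)] q(3)
    by (intro exI[of _ "p @ q"] exI[of _ "p @ q'"]) simp
qed

section \<open>Reachability inside a vertex set and components\<close>

lemma linked_refl [simp]: "linked E S x x"
  by (simp add: linked_def)

lemma linked_trans: "linked E S x y \<Longrightarrow> linked E S y z \<Longrightarrow> linked E S x z"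
  by (auto simp: linked_def)

lemma linked_step: "linked E S x y \<Longrightarrow> y \<in> S \<Longrightarrow> z \<in> S \<Longrightarrow> E y z \<Longrightarrow> linked E S x z"
  by (auto simp: linked_def intro: rtranclp.rtrancl_into_rtrancl)

lemma linked_sym:
  assumes "symp E" "linked E S x y"
  shows "linked E S y x"
proof -
  have "symp (\<lambda>u v. u \<in> S \<and> v \<in> S \<and> E u v)"
    using assms(1) by (auto simp: symp_def)
  then show ?thesis
    using assms(2) unfolding linked_def by (metis symp_rtranclp sympD)
qed

lemma linked_crossing:
  assumes "linked E S x y" "x \<in> K" "y \<notin> K"
  shows "\<exists>u v. u \<in> K \<and> v \<in> S - K \<and> E u v"
  using assms unfolding linked_def
  by (induction rule: rtranclp_induct) blast+

text \<open>When the walk returns to a vertex of the path built so far, the path is cut back to that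
  vertex.\<close>

lemma linked_imp_upath:
  assumes "linked E S x y" "x \<in> S"
  shows "\<exists>p. upath E S x y p"
  using assms(1) unfolding linked_def
proof (induction rule: rtranclp_induct)
  case base
  show ?case using assms(2) by (intro exI[of _ "[x]"]) simp
next
  case (step y z)
  then obtain p where p: "upath E S x y p" by blast
  show ?case
  proof (cases "z \<in> set p")
    case True
    then obtain as bs where "p = as @ z # bs"
      by (meson split_list)
    then have "upath E S x z (as @ [z])"
      using p by (auto simp: upath_def successively_append_iff successively_Cons hd_append)
    then show ?thesis by blast
  next
    case False
    then have "upath E S x z (p @ [z])"
      using p step.hyps(2) by (auto simp: upath_def successively_append_iff)
    then show ?thesis by blast
  qed
qed

lemma conn_imp_upath: "conn E K \<Longrightarrow> x \<in> K \<Longrightarrow> y \<in> K \<Longrightarrow> \<exists>p. upath E K x y p"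
  by (simp add: conn_def linked_imp_upath)

lemma component_of_subset: "component_of E S x \<subseteq> S"
  by (auto simp: component_of_def)

lemma component_of_self: "x \<in> S \<Longrightarrow> x \<in> component_of E S x"
  by (auto simp: component_of_def)

lemma component_of_closed:
  "k \<in> component_of E S x \<Longrightarrow> v \<in> S \<Longrightarrow> E k v \<Longrightarrow> v \<in> component_of E S x"
  by (auto simp: component_of_def intro: linked_step)

text \<open>A walk inside \<open>S\<close> that starts at \<open>x\<close> never leaves the
  component of \<open>x\<close>.\<close>

lemma linked_component_of:
  assumes "linked E S x y" "x \<in> S"
  shows "linked E (component_of E S x) x y"
proof -
  have "y \<in> component_of E S x \<and> linked E (component_of E S x) x y"
    using assms(1) unfolding linked_def[of E S]
  proof (induction rule: rtranclp_induct)
    case base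
    show ?case using assms(2) by (simp add: component_of_self)
  next
    case (step y z)
    then show ?case
      by (meson component_of_closed linked_step)
  qed
  then show ?thesis by blast
qed

lemma conn_component_of:
  assumes "symp E" "x \<in> S"
  shows "conn E (component_of E S x)"
  unfolding conn_def
proof (intro ballI)
  fix y z assume "y \<in> component_of E S x" "z \<in> component_of E S x"
  then have "linked E (component_of E S x) x y" "linked E (component_of E S x) x z"
    using linked_component_of[OF _ assms(2)] by (simp_all add: component_of_def)
  then show "linked E (component_of E S x) y z"
    using assms(1) by (meson linked_sym linked_trans)
qed

lemma two_le_cardI: "finite A \<Longrightarrow> a \<in> A \<Longrightarrow> b \<in> A \<Longrightarrow> a \<noteq> b \<Longrightarrow> 2 \<le> card A"
  using card_mono[of A "{a, b}"] by simp

lemma two_le_cardE: 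
  assumes "2 \<le> card A"
  obtains b where "b \<in> A" "b \<noteq> a"
proof -
  have "\<not> A \<subseteq> {a}"
    using assms card_mono[of "{a}" A] by auto
  then show ?thesis using that by blast
qed

section \<open>Two paths of lengths differing by two in a rooted graph\<close>

text \<open>
  The condition on boundaries says that adding the edge between the two roots makes the graph
  2-connected.
\<close>

definition rooted :: "'a set \<Rightarrow> ('a \<Rightarrow> 'a \<Rightarrow> bool) \<Rightarrow> 'a \<Rightarrow> 'a \<Rightarrow> bool" where
  "rooted V E c b \<longleftrightarrow>
     finite V \<and> c \<in> V \<and> b \<in> V \<and> c \<noteq> b \<and> V - {c, b} \<noteq> {} \<and> \<not> E c b \<and> symp E \<and> irreflp E \<and>
     (\<forall>K. K \<subseteq> V - {c, b} \<longrightarrow> K \<noteq> {} \<longrightarrow> 2 \<le> card (boundary V E K)) \<and>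
     (\<forall>v \<in> V - {c, b}. 4 \<le> card {u \<in> V. E v u})"

text \<open>The contracted vertex is the target of the paths in the induction below, but their
  starting root when a component is attached to an odd cycle.\<close>

lemma rooted_commute: "rooted V E c b \<longleftrightarrow> rooted V E b c"
proof -
  have "rooted V E y x" if "rooted V E x y" for x y
    using that unfolding rooted_def by (auto simp: insert_commute dest: sympD)
  then show ?thesis by blast
qed

text \<open>
  Here \<open>b\<close> is reused as the name of the vertex obtained by contracting \<open>B - {r}\<close>; the other root
  \<open>r\<close> may itself belong to \<open>B\<close>.
\<close>

definition contraction ::
  "('a \<Rightarrow> 'a \<Rightarrow> bool) \<Rightarrow> 'a set \<Rightarrow> 'a set \<Rightarrow> 'a \<Rightarrow> 'a \<Rightarrow> 'a \<Rightarrow> 'a \<Rightarrow> bool" where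
  "contraction E K B r b u v \<longleftrightarrow>
     u \<in> insert r K \<and> v \<in> insert r K \<and> E u v \<or>
     u = b \<and> v \<in> K \<and> (\<exists>j \<in> B - {r}. E v j) \<or>
     v = b \<and> u \<in> K \<and> (\<exists>j \<in> B - {r}. E u j)"

text \<open>Contraction lowers a degree only where edges become parallel, which \<open>uniq\<close>
  excludes. For a proper subset of \<open>K\<close>, connectedness gives a boundary vertex in
  \<open>K\<close>, and \<open>bd\<close> gives a second one, which stays distinct even if it is
  absorbed into \<open>b\<close>.\<close>

lemma rooted_contraction:
  assumes fin: "finite V" and sym: "symp E" and irr: "irreflp E"
    and KV: "K \<subseteq> V" and conn: "conn E K" and out: "r \<notin> K" "b \<notin> K" "r \<noteq> b" "r \<in> V"
    and nbr: "\<And>k v. k \<in> K \<Longrightarrow> v \<in> V \<Longrightarrow> E k v \<Longrightarrow> v \<in> K \<union> {r} \<union> B"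
    and r: "k\<^sub>1 \<in> K" "E k\<^sub>1 r" and B: "k\<^sub>2 \<in> K" "j \<in> B - {r}" "E k\<^sub>2 j"
    and bd: "\<And>K'. K' \<subset> K \<Longrightarrow> K' \<noteq> {} \<Longrightarrow> 2 \<le> card (boundary V E K')"
    and deg: "\<And>k. k \<in> K \<Longrightarrow> 4 \<le> card {u \<in> V. E k u}"
    and uniq: "\<And>k i j. k \<in> K \<Longrightarrow> i \<in> B - {r} \<Longrightarrow> j \<in> B - {r} \<Longrightarrow> E k i \<Longrightarrow> E k j \<Longrightarrow> i = j"
  shows "rooted (insert r (insert b K)) (contraction E K B r b) r b"
proof -
  let ?V = "insert r (insert b K)" and ?E = "contraction E K B r b"
  have finK: "finite K" using fin KV by (rule rev_finite_subset)
  have "\<not> ?E r b" using out by (auto simp: contraction_def)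
  moreover have "symp ?E"
    using sym by (auto simp: symp_def contraction_def)
  moreover have "irreflp ?E"
    using irr out by (auto simp: irreflp_def contraction_def)
  moreover have "2 \<le> card (boundary ?V ?E K')" if K': "K' \<subseteq> ?V - {r, b}" "K' \<noteq> {}" for K'
  proof -
    have K'K: "K' \<subseteq> K" using K' by auto
    have fin': "finite (boundary ?V ?E K')" using finK by (simp add: boundary_def)
    show ?thesis
    proof (cases "K' = K")
      case True
      have "r \<in> boundary ?V ?E K'" "b \<in> boundary ?V ?E K'"
        using True r B out by (auto simp: boundary_def contraction_def)
      then show ?thesis using two_le_cardI[OF fin'] out by blast
    next
      case False
      then obtain x y where "x \<in> K'" "y \<in> K - K'" using K'K K'(2) by blast
      then have "linked E K x y" using conn K'K by (auto simp: conn_def)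
      then obtain u v where uv: "u \<in> K'" "v \<in> K - K'" "E u v"
        using linked_crossing \<open>x \<in> K'\<close> \<open>y \<in> K - K'\<close> by (metis DiffD2)
      have v: "v \<in> boundary ?V ?E K'"
        using uv K'K by (auto simp: boundary_def contraction_def)
      have "2 \<le> card (boundary V E K')" using bd False K'K K'(2) by blast
      then obtain w where "w \<in> boundary V E K'" "w \<noteq> v" by (rule two_le_cardE)
      then obtain k where w: "w \<in> V" "w \<notin> K'" "k \<in> K'" "E k w" "w \<noteq> v"
        by (auto simp: boundary_def)
      show ?thesis
      proof (cases "w \<in> insert r K")
        case True
        then have "w \<in> boundary ?V ?E K'"
          using w K'K by (auto simp: boundary_def contraction_def)
        then show ?thesis using two_le_cardI[OF fin' v] w(5) by blast
      next
        case False
        then have "w \<in> B - {r}" using nbr[of k w] w K'K by blast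
        then have "b \<in> boundary ?V ?E K'"
          using w K'K out by (auto simp: boundary_def contraction_def)
        then show ?thesis using two_le_cardI[OF fin' v] uv(2) out by blast
      qed
    qed
  qed
  moreover have "4 \<le> card {u \<in> ?V. ?E k u}" if "k \<in> ?V - {r, b}" for k
  proof -
    have k: "k \<in> K" using that by auto
    \<comment> \<open>Neighbours in \<open>B - {r}\<close> go to \<open>b\<close>. By
      \<open>uniq\<close> at most one neighbour is of this kind, so the map is injective.\<close>
    let ?f = "\<lambda>u. if u \<in> insert r K then u else b"
    have "card {u \<in> V. E k u} \<le> card {u \<in> ?V. ?E k u}"
    proof (rule card_inj_on_le)
      show "inj_on ?f {u \<in> V. E k u}"
        using nbr[OF k] uniq[OF k] out by (auto simp: inj_on_def split: if_splits)
      show "?f ` {u \<in> V. E k u} \<subseteq> {u \<in> ?V. ?E k u}"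
        using nbr[OF k] k by (auto simp: contraction_def)
    qed (simp add: finK)
    then show ?thesis using deg[OF k] by simp
  qed
  ultimately show ?thesis
    unfolding rooted_def using out finK r(1) by (intro conjI allI impI ballI) auto
qed

text \<open>Only the last edge of the path can be a contracted one. It is expanded to an edge into
  some \<open>j\<close> of \<open>B - {r}\<close> followed by the edge from \<open>j\<close> to
  \<open>b\<close>. Recording that \<open>j\<close> has a neighbour in \<open>K\<close> lets other
  vertices of \<open>B\<close> be kept off the lifted path.\<close>

lemma upath_contraction_lift:
  assumes "upath (contraction E K B r b) (insert b K) w b p" "w \<in> K"
    and "r \<notin> K" "b \<notin> K" "B \<inter> K = {}" "b \<notin> B" "\<And>j. j \<in> B \<Longrightarrow> E j b" "r \<noteq> b"
  shows "\<exists>q. upath E (insert b (K \<union> {j \<in> B - {r}. \<exists>k\<in>K. E k j})) w b q \<and> length q = Suc (length p)"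
proof -
  have "p \<noteq> [b]"
    using assms(1,2,4) unfolding upath_def by (metis list.sel(1))
  then obtain p' where p: "p = p' @ [b]" "p' \<noteq> []"
    using assms(1) unfolding upath_def by (metis append_butlast_last_id append_Nil)
  have p'K: "set p' \<subseteq> K" and dist: "distinct p'" and hd: "hd p' = w"
    and suc: "successively (contraction E K B r b) p'" 
    and con: "contraction E K B r b (last p') b"
    using assms(1) p by (auto simp: upath_def successively_append_iff)
  have sucE: "successively E p'"
    using suc by (rule successively_mono) (use p'K assms in \<open>auto simp: contraction_def\<close>)
  have last: "last p' \<in> K" using p'K p(2) by auto
  obtain j where j: "j \<in> B - {r}" "E (last p') j"
    using con last assms(3,4,8) by (auto simp: contraction_def)
  have "upath E (insert b (K \<union> {j \<in> B - {r}. \<exists>k\<in>K. E k j})) w b (p' @ [j, b])"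
    using p'K dist hd sucE last j p(2) assms(4-7) unfolding upath_def
    by (auto simp: successively_append_iff)
  then show ?thesis using p by (intro exI[of _ "p' @ [j, b]"]) simp
qed

lemma two_paths_contraction_lift:
  assumes "two_paths (contraction E K B r b) (insert b K) w b" "w \<in> K"
    and "r \<notin> K" "b \<notin> K" "B \<inter> K = {}" "b \<notin> B" "\<And>j. j \<in> B \<Longrightarrow> E j b" "r \<noteq> b"
  shows "two_paths E (insert b (K \<union> {j \<in> B - {r}. \<exists>k\<in>K. E k j})) w b"
proof -
  obtain p q where pq: "upath (contraction E K B r b) (insert b K) w b p"
    "upath (contraction E K B r b) (insert b K) w b q" "length q = length p + 2"
    using assms(1) by (auto simp: two_paths_def)
  let ?S = "insert b (K \<union> {j \<in> B - {r}. \<exists>k\<in>K. E k j})"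
  obtain p' q' where "upath E ?S w b p'" "length p' = Suc (length p)"
    "upath E ?S w b q'" "length q' = Suc (length q)"
    using upath_contraction_lift[OF pq(1) assms(2-8)] upath_contraction_lift[OF pq(2) assms(2-8)]
    by blast
  then show ?thesis
    using pq(3) unfolding two_paths_def by (intro exI[of _ p'] exI[of _ q']) simp
qed

lemma rooted_two_paths:
  assumes "rooted V E c b"
  shows "\<exists>x \<in> V - {c}. E c x \<and> two_paths E (V - {c}) x b"
  using assms
proof (induction "card V" arbitrary: V E c b rule: less_induct)
  case less
  have fin: "finite V" and cV: "c \<in> V" and bV: "b \<in> V" and cb: "c \<noteq> b" and ne: "V - {c, b} \<noteq> {}"
    and ncb: "\<not> E c b" and sym: "symp E" and irr: "irreflp E"
    and bd: "\<And>K. K \<subseteq> V - {c, b} \<Longrightarrow> K \<noteq> {} \<Longrightarrow> 2 \<le> card (boundary V E K)"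
    and deg: "\<And>v. v \<in> V - {c, b} \<Longrightarrow> 4 \<le> card {u \<in> V. E v u}"
    using less.prems unfolding rooted_def by blast+
  have E_sym: "E u v \<longleftrightarrow> E v u" for u v using sym by (meson sympD)
  have E_irr: "\<not> E u u" for u using irr by (rule irreflpD)
  define B where "B = {j \<in> V. E b j}"
  have BV: "B \<subseteq> V" and bB: "b \<notin> B" and cB: "c \<notin> B"
    using ncb E_sym E_irr by (auto simp: B_def)
  show ?case
  proof (cases "\<exists>z b\<^sub>1 b\<^sub>2. z \<in> V - B - {b, c} \<and> b\<^sub>1 \<in> B \<and> b\<^sub>2 \<in> B \<and> b\<^sub>1 \<noteq> b\<^sub>2 \<and> E z b\<^sub>1 \<and> E z b\<^sub>2")
    case True
    then obtain z b\<^sub>1 b\<^sub>2 where z: "z \<in> V - B - {b, c}" "b\<^sub>1 \<in> B" "b\<^sub>2 \<in> B" "b\<^sub>1 \<noteq> b\<^sub>2" "E z b\<^sub>1" "E z b\<^sub>2"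
      by blast
    \<comment> \<open>\<open>T\<close> is what \<open>c\<close> reaches without meeting the 4-cycle.
      If \<open>T\<close> touches \<open>b\<^sub>1\<close> or \<open>b\<^sub>2\<close>, the detour
      applies; otherwise all neighbours of \<open>T\<close> outside it are among \<open>b\<close>
      and \<open>z\<close>.\<close>
    define T where "T = component_of E (V - {b, z, b\<^sub>1, b\<^sub>2}) c"
    have TV: "T \<subseteq> V - {b, z, b\<^sub>1, b\<^sub>2}" unfolding T_def by (rule component_of_subset)
    have cT: "c \<in> T" unfolding T_def using z cV cb cB by (intro component_of_self) auto
    have conT: "conn E T" unfolding T_def using z cV cb cB sym by (intro conn_component_of) auto
    have closed: "\<And>t v. t \<in> T \<Longrightarrow> v \<in> V \<Longrightarrow> E t v \<Longrightarrow> v \<in> T \<union> {b, z, b\<^sub>1, b\<^sub>2}"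
      unfolding T_def using component_of_closed[of _ E "V - {b, z, b\<^sub>1, b\<^sub>2}" c] by blast
    \<comment> \<open>Detouring through the 4-cycle on b, b1, z, b2 lengthens a path by two.\<close>
    have detour: ?thesis
      if t: "t \<in> T" "E t y" and y: "y \<in> B" "E z y" and y': "y' \<in> B" "E z y'" "y' \<noteq> y"
        and yT: "y \<notin> T" "y' \<notin> T" for t y y'
    proof -
      obtain p where p: "upath E T c t p" using conn_imp_upath[OF conT cT t(1)] by blast
      \<comment> \<open>This is the second vertex of \<open>p @ [y]\<close>, namely \<open>y\<close>
        itself when \<open>t = c\<close>.\<close>
      define x where "x = hd (tl p @ [y])"
      have hdp: "p = c # tl p" and dist: "distinct p" and suc: "successively E p"
        and lastp: "last p = t" and setp: "set p \<subseteq> T"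
        using p by (auto simp: upath_def)
      have sucy: "successively E (c # tl p @ [y])"
        using suc lastp t(2) hdp successively_append_iff[of E p "[y]"]
        by (metis append_Cons list.sel(1) successively.simps(2))
      then have cx: "E c x" and suc': "successively E (tl p @ [y])"
        by (auto simp: x_def successively_Cons)
      have "distinct (c # tl p)" "set (c # tl p) \<subseteq> T"
        using hdp dist setp by simp_all
      then have set': "set (tl p) \<subseteq> T - {c}" and dist': "distinct (tl p)"
        by auto
      have xV: "x \<in> V - {c}"
      proof (cases "tl p")
        case Nil
        then show ?thesis using y BV cB by (auto simp: x_def)
      next
        case (Cons d l)
        then show ?thesis using set' TV by (auto simp: x_def)
      qed
      have edges: "E y b" "E y' b" "E y z" using y y' E_sym by (auto simp: B_def)
      have new: "distinct [y, z, y', b]" "set [y, z, y', b] \<subseteq> V - {c} - T"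
        using y y' yT z BV bB cB cb bV TV by auto
      have "upath E (V - {c}) x b (tl p @ [y, b])"
        using suc' set' dist' TV new edges(1) unfolding upath_def x_def
        by (auto simp: successively_append_iff hd_append)
      moreover have "upath E (V - {c}) x b (tl p @ [y, z, y', b])"
        using suc' set' dist' TV new edges(2,3) y'(2) unfolding upath_def x_def
        by (auto simp: successively_append_iff hd_append)
      ultimately have "two_paths E (V - {c}) x b"
        unfolding two_paths_def
        by (intro exI[of _ "tl p @ [y, b]"] exI[of _ "tl p @ [y, z, y', b]"]) simp
      then show ?thesis using cx xV by blast
    qed
    have b12: "b\<^sub>1 \<notin> T" "b\<^sub>2 \<notin> T" using TV by auto
    show ?thesis
    proof (cases "\<exists>t\<in>T. E t b\<^sub>1 \<or> E t b\<^sub>2")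
      case True
      then show ?thesis
        using detour[of _ b\<^sub>1 b\<^sub>2] detour[of _ b\<^sub>2 b\<^sub>1] z b12 by blast
    next
      case False
      then have closed': "v \<in> T \<union> {b, z}" if "t \<in> T" "v \<in> V" "E t v" for t v
        using closed[OF that] that by auto
      let ?V = "V - T"
      obtain t where t: "t \<in> T" "E t z"
      proof -
        \<comment> \<open>A boundary vertex of \<open>?K\<close> other than \<open>b\<close> lies in
          \<open>T\<close>, and its neighbour in \<open>?K\<close> can only be
          \<open>z\<close>.\<close>
        let ?K = "V - T - {b}"
        have "2 \<le> card (boundary V E ?K)"
          using z cT TV by (intro bd) auto
        then obtain w where w: "w \<in> boundary V E ?K" "w \<noteq> b" by (rule two_le_cardE)
        then obtain k where "w \<in> T" "k \<in> V - T - {b}" "E k w" by (auto simp: boundary_def)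
        then have "k = z" using closed'[of w k] E_sym by blast
        then show ?thesis using \<open>w \<in> T\<close> \<open>E k w\<close> E_sym that by blast
      qed
      \<comment> \<open>Deleting \<open>T\<close> takes no neighbours from vertices other than
        \<open>z\<close> and \<open>b\<close>, so \<open>z\<close> can replace \<open>c\<close> as a
        root.\<close>
      have "rooted ?V E z b"
        unfolding rooted_def
      proof (intro conjI allI impI ballI)
        show "finite ?V" "z \<in> ?V" "b \<in> ?V" "z \<noteq> b" "symp E" "irreflp E"
          using fin z TV bV sym irr by auto
        show "?V - {z, b} \<noteq> {}" using z b12 BV bB by auto
        show "\<not> E z b" using z E_sym by (auto simp: B_def)
      next
        fix K assume K: "K \<subseteq> ?V - {z, b}" "K \<noteq> {}"
        have "boundary ?V E K = boundary V E K"
          using K closed' E_sym by (fastforce simp: boundary_def)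
        then show "2 \<le> card (boundary ?V E K)" using bd[of K] K cT by auto
      next
        fix v assume v: "v \<in> ?V - {z, b}"
        have "{u \<in> ?V. E v u} = {u \<in> V. E v u}"
          using v closed' E_sym by fastforce
        then show "4 \<le> card {u \<in> ?V. E v u}" using deg[of v] v cT by auto
      qed
      moreover have "card ?V < card V"
        using fin cT cV by (intro psubset_card_mono) auto
      ultimately obtain w where w: "w \<in> ?V - {z}" "E z w" "two_paths E (?V - {z}) w b"
        using less.hyps by blast
      obtain p where p: "upath E T c t p" using conn_imp_upath[OF conT cT t(1)] by blast
      have pz: "upath E (insert z T) c z (p @ [z])"
        using upath_append[OF p, of "{z}" z z "[z]"] t TV by auto
      define x where "x = hd (tl p @ [z])"
      have "p @ [z] = c # tl p @ [z]" using p by (auto simp: upath_def)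
      with pz have "upath E (insert z T) c z (c # tl p @ [z])"
        by metis
      then have cx: "E c x" and px: "upath E (insert z T - {c}) x z (tl p @ [z])"
        unfolding upath_def x_def by (auto simp: successively_Cons)
      have "two_paths E ((insert z T - {c}) \<union> (?V - {z})) x b"
        using two_paths_prepend[OF px w(3,2)] by auto
      then have "two_paths E (V - {c}) x b"
        by (rule two_paths_mono) (use z TV cT in auto)
      moreover have "x \<in> V - {c}"
        using upath_hd_in[OF px] z TV by blast
      ultimately show ?thesis using cx by blast
    qed
  next
    case False
    then have uniq: "\<And>k i j. k \<in> V - B - {b, c} \<Longrightarrow> i \<in> B \<Longrightarrow> j \<in> B \<Longrightarrow> E k i \<Longrightarrow> E k j \<Longrightarrow> i = j"
      by blast
    define S where "S = V - B - {b, c}"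
    have nbrB: "v \<in> B" if "v \<in> V" "E b v" for v using that by (simp add: B_def)
    \<comment> \<open>The condition on \<open>r\<close> ensures that edges leaving the component of
      \<open>k\<close> end in \<open>B\<close> or at \<open>r\<close>. Contracting
      \<open>B - {r}\<close> into \<open>b\<close> then gives a smaller graph rooted at
      \<open>r\<close> and \<open>b\<close>, and the paths found there lift back.\<close>
    have contract: "\<exists>w \<in> component_of E S k. E r w \<and>
        two_paths E (insert b (component_of E S k \<union>
          {j \<in> B - {r}. \<exists>k' \<in> component_of E S k. E k' j})) w b"
      if k: "k \<in> S" "E k r" and r: "r = c \<or> r \<in> B \<and> (\<forall>k\<in>S. \<not> E k c)" for k r
    proof -
      define K where "K = component_of E S k"
      have KS: "K \<subseteq> S" unfolding K_def by (rule component_of_subset)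
      have kK: "k \<in> K" unfolding K_def using k(1) by (rule component_of_self)
      have connK: "conn E K" unfolding K_def using sym k(1) by (rule conn_component_of)
      have bK: "b \<notin> K" and cK: "c \<notin> K" and BK: "B \<inter> K = {}"
        using KS by (auto simp: S_def)
      have "r = c \<or> r \<in> B" using r by blast
      then have rV: "r \<in> V" and rb: "r \<noteq> b" and rK: "r \<notin> K"
        using cV cb BV bB cK BK by blast+
      have nbr: "v \<in> K \<union> {r} \<union> B" if kv: "k' \<in> K" "v \<in> V" "E k' v" for k' v
      proof (cases "v \<in> S")
        case True
        then show ?thesis using component_of_closed[of k' E S k v] kv by (auto simp: K_def)
      next
        case False
        moreover have "v \<noteq> b" using nbrB[of k'] kv KS E_sym[of b k'] by (auto simp: S_def)
        moreover have "v = c \<Longrightarrow> r = c" using r kv(1,3) KS by blast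
        ultimately show ?thesis using kv(2) by (auto simp: S_def)
      qed
      have "2 \<le> card (boundary V E K)" using KS kK by (intro bd) (auto simp: S_def)
      then obtain j where "j \<in> boundary V E K" "j \<noteq> r" by (rule two_le_cardE)
      then obtain k\<^sub>2 where j: "j \<in> V" "j \<notin> K" "j \<noteq> r" "k\<^sub>2 \<in> K" "E k\<^sub>2 j"
        by (auto simp: boundary_def)
      then have jB: "j \<in> B - {r}" using nbr[of k\<^sub>2 j] by auto
      have "rooted (insert r (insert b K)) (contraction E K B r b) r b"
      proof (rule rooted_contraction[where V = V and k\<^sub>1 = k and k\<^sub>2 = k\<^sub>2 and j = j])
        show "K \<subseteq> V" using KS by (auto simp: S_def)
        show "2 \<le> card (boundary V E K')" if "K' \<subset> K" "K' \<noteq> {}" for K'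
          using that KS by (intro bd) (auto simp: S_def)
        show "4 \<le> card {u \<in> V. E k u}" if "k \<in> K" for k
          using that KS by (intro deg) (auto simp: S_def)
        show "i = j" if "k \<in> K" "i \<in> B - {r}" "j \<in> B - {r}" "E k i" "E k j" for k i j
          using that KS by (intro uniq[of k i j]) (auto simp: S_def)
      qed (use fin sym irr connK rV rb rK bK nbr kK k j jB in auto)
      moreover have "card (insert r (insert b K)) < card V"
      proof (rule psubset_card_mono[OF fin])
        have "insert r (insert b K) \<subseteq> V" using rV bV KS by (auto simp: S_def)
        \<comment> \<open>Some vertex is lost: \<open>j\<close> if \<open>r = c\<close>, and
          \<open>c\<close> otherwise.\<close>
        moreover have "insert r (insert b K) \<noteq> V"
        proof (cases "r = c")
          case True
          then show ?thesis using jB BV BK bB by auto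
        next
          case False
          then show ?thesis using cV cb KS by (auto simp: S_def)
        qed
        ultimately show "insert r (insert b K) \<subset> V" by blast
      qed
      ultimately obtain w where w: "w \<in> insert r (insert b K) - {r}" "contraction E K B r b r w"
        "two_paths (contraction E K B r b) (insert r (insert b K) - {r}) w b"
        using less.hyps by blast
      have wK: "w \<in> K" "E r w"
        using w(1,2) rb rK bK by (auto simp: contraction_def)
      have "two_paths (contraction E K B r b) (insert b K) w b"
        using w(3) by (rule two_paths_mono) auto
      then have "two_paths E (insert b (K \<union> {j \<in> B - {r}. \<exists>k\<in>K. E k j})) w b"
        by (rule two_paths_contraction_lift) (use wK rK bK BK bB rb E_sym in \<open>auto simp: B_def\<close>)
      then show ?thesis using wK unfolding K_def by blast
    qed
    have comp_S: "component_of E S k \<subseteq> S" for k by (rule component_of_subset)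
    show ?thesis
    proof (cases "\<exists>k\<in>S. E k c")
      case True
      then obtain k where k: "k \<in> S" "E k c" by blast
      obtain w where w: "w \<in> component_of E S k" "E c w"
        "two_paths E (insert b (component_of E S k \<union>
          {j \<in> B - {c}. \<exists>k' \<in> component_of E S k. E k' j})) w b"
        using contract[OF k] by blast
      have "two_paths E (V - {c}) w b"
        using w(3) by (rule two_paths_mono) (use comp_S BV bV cb in \<open>auto simp: S_def\<close>)
      then show ?thesis using w(1,2) comp_S by (auto simp: S_def)
    next
      case False
      then have nc: "\<forall>k\<in>S. \<not> E k c" by blast
      obtain x where x: "x \<in> V" "E c x"
      proof -
        \<comment> \<open>This boundary is contained in \<open>{c, b}\<close>, so having two
          vertices it contains \<open>c\<close>.\<close>
        have "2 \<le> card (boundary V E (V - {c, b}))" using ne by (intro bd) auto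
        then obtain w where "w \<in> boundary V E (V - {c, b})" "w \<noteq> b" by (rule two_le_cardE)
        then show ?thesis using that E_sym by (auto simp: boundary_def)
      qed
      have xb: "x \<noteq> b" "x \<noteq> c" using x ncb E_irr by auto
      then have xB: "x \<in> B" using x nc E_sym by (auto simp: S_def)
      have Exb: "E x b" using xB E_sym by (auto simp: B_def)
      show ?thesis
      proof (cases "\<exists>k\<in>S. E k x")
        case True
        then obtain k where k: "k \<in> S" "E k x" by blast
        let ?U = "insert b (component_of E S k \<union> {j \<in> B - {x}. \<exists>k' \<in> component_of E S k. E k' j})"
        obtain w where w: "E x w" "two_paths E ?U w b"
          using contract[OF k] xB nc by blast
        have "two_paths E ({x} \<union> ?U) x b"
          by (rule two_paths_prepend[of _ _ _ x "[x]", OF _ w(2,1)])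
            (use xb xB comp_S in \<open>auto simp: S_def\<close>)
        then have "two_paths E (V - {c}) x b"
          by (rule two_paths_mono) (use x xb cb bV cB BV comp_S in \<open>auto simp: S_def\<close>)
        then show ?thesis using x xb by blast
      next
        case False
        \<comment> \<open>The vertices \<open>b\<close> and \<open>c\<close> cannot supply four
          neighbours of \<open>x\<close>, and none is in \<open>S\<close>, so \<open>x\<close> has a
          neighbour \<open>y\<close> in \<open>B\<close>.\<close>
        have card2: "card {b, c} \<le> 2" by (simp add: card_insert_if)
        have "\<not> {u \<in> V. E x u} \<subseteq> {b, c}"
        proof
          assume "{u \<in> V. E x u} \<subseteq> {b, c}"
          then have "card {u \<in> V. E x u} \<le> card {b, c}" by (intro card_mono) auto
          then show False using deg[of x] x xb card2 by auto
        qed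
        then obtain y where y: "y \<in> V" "E x y" "y \<noteq> b" "y \<noteq> c" by blast
        have yB: "y \<in> B" using y False E_sym by (auto simp: S_def)
        have yx: "y \<noteq> x" using y E_irr by auto
        have Eyb: "E y b" using yB E_sym by (auto simp: B_def)
        show ?thesis
        proof (cases "\<exists>z\<in>B - {x}. E y z")
          case True
          then obtain z where z: "z \<in> B" "z \<noteq> x" "E y z" by blast
          have "z \<noteq> y" "E z b" using z E_irr E_sym by (auto simp: B_def)
          then have "upath E (V - {c}) x b [x, b]" "upath E (V - {c}) x b [x, y, z, b]"
            using x xb y yx z Exb BV bV cb cB bB by (auto simp: upath_def)
          then have "two_paths E (V - {c}) x b"
            unfolding two_paths_def by (intro exI[of _ "[x, b]"] exI[of _ "[x, y, z, b]"]) simp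
          then show ?thesis using x xb by blast
        next
          case False': False
          \<comment> \<open>Here \<open>x\<close> is the only possible neighbour of \<open>y\<close>
            in \<open>B\<close>, so the degree of \<open>y\<close> forces a neighbour in
            \<open>S\<close>, and the contraction applies with root \<open>y\<close>.\<close>
          have card3: "card {b, c, x} \<le> 3" by (simp add: card_insert_if)
          have "\<not> {u \<in> V. E y u} \<subseteq> {b, c, x}"
          proof
            assume "{u \<in> V. E y u} \<subseteq> {b, c, x}"
            then have "card {u \<in> V. E y u} \<le> card {b, c, x}" by (intro card_mono) auto
            then show False using deg[of y] y card3 by auto
          qed
          then obtain k where k: "k \<in> V" "E y k" "k \<noteq> b" "k \<noteq> c" "k \<noteq> x" by blast
          then have kS: "k \<in> S" "E k y" using False' E_sym by (auto simp: S_def)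
          let ?U = "insert b (component_of E S k \<union> {j \<in> B - {y}. \<exists>k' \<in> component_of E S k. E k' j})"
          obtain w where w: "E y w" "two_paths E ?U w b"
            using contract[OF kS] yB nc by blast
          \<comment> \<open>Members of \<open>B\<close> in \<open>?U\<close> have a neighbour in the
            component, whereas \<open>x\<close> has none in \<open>S\<close>.\<close>
          have xU: "x \<notin> ?U" using xb xB False comp_S by (auto simp: S_def)
          have "upath E {x, y} x y [x, y]" using y yx by (auto simp: upath_def)
          then have "two_paths E ({x, y} \<union> ?U) x b"
            by (rule two_paths_prepend[OF _ w(2,1)])
              (use xU y yB comp_S in \<open>auto simp: S_def\<close>)
          then have "two_paths E (V - {c}) x b"
            by (rule two_paths_mono) (use x xb y cb bV cB BV comp_S in \<open>auto simp: S_def\<close>)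
          then show ?thesis using x xb by blast
        qed
      qed
    qed
  qed
qed

section \<open>Closed walks and cycles\<close>

text \<open>The first vertex is not repeated at the end, so the length of the list is the number of
  edges. Vertices may recur.\<close>

definition cwalk :: "('a \<Rightarrow> 'a \<Rightarrow> bool) \<Rightarrow> 'a list \<Rightarrow> bool" where
  "cwalk E xs \<longleftrightarrow> xs \<noteq> [] \<and> successively E xs \<and> E (last xs) (hd xs)"

definition ucycle :: "('a \<Rightarrow> 'a \<Rightarrow> bool) \<Rightarrow> 'a list \<Rightarrow> bool" where
  "ucycle E xs \<longleftrightarrow> 3 \<le> length xs \<and> distinct xs \<and> cwalk E xs"

definition consecutive_odd_cycles :: "('a \<Rightarrow> 'a \<Rightarrow> bool) \<Rightarrow> bool" where
  "consecutive_odd_cycles E \<longleftrightarrow>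
     (\<exists>xs ys. ucycle E xs \<and> ucycle E ys \<and> odd (length xs) \<and> length ys = length xs + 2)"

text \<open>Minimality ranges over closed walks, so that competitors need not be checked for
  repeated vertices.\<close>

definition min_odd_cwalk :: "('a \<Rightarrow> 'a \<Rightarrow> bool) \<Rightarrow> 'a list \<Rightarrow> bool" where
  "min_odd_cwalk E xs \<longleftrightarrow> cwalk E xs \<and> odd (length xs) \<and>
     (\<forall>ys. cwalk E ys \<longrightarrow> odd (length ys) \<longrightarrow> length xs \<le> length ys)"

lemma cwalk_rotate: "cwalk E (xs @ ys) \<Longrightarrow> cwalk E (ys @ xs)"
  by (cases "xs = []"; cases "ys = []") (auto simp: cwalk_def successively_append_iff)

section \<open>Shortest odd closed walks\<close>

lemma min_odd_cwalk_rotate: "min_odd_cwalk E (xs @ ys) \<Longrightarrow> min_odd_cwalk E (ys @ xs)"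
  by (auto simp: min_odd_cwalk_def intro: cwalk_rotate)

lemma min_odd_cwalk_split:
  assumes "min_odd_cwalk E C" "distinct C" "x \<in> set C" "y \<in> set C" "x \<noteq> y"
  obtains A B where "min_odd_cwalk E (x # A @ y # B)" "distinct (x # A @ y # B)"
    "set C = set (x # A @ y # B)"
proof -
  obtain P Q where C: "C = P @ x # Q" using assms(3) by (meson split_list)
  have "y \<in> set (Q @ P)" using assms(4,5) C by auto
  then obtain A B where QP: "Q @ P = A @ y # B" by (meson split_list)
  have "min_odd_cwalk E ((x # Q) @ P)" using assms(1) C min_odd_cwalk_rotate by blast
  moreover have "distinct ((x # Q) @ P)" "set C = set ((x # Q) @ P)" using assms(2) C by auto
  ultimately show ?thesis using that QP by auto
qed

lemma cwalk_imp_min_odd_cwalk: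
  assumes "cwalk E xs" "odd (length xs)"
  obtains C where "min_odd_cwalk E C"
proof -
  have "\<exists>C. (cwalk E C \<and> odd (length C)) \<and>
      (\<forall>ys. cwalk E ys \<and> odd (length ys) \<longrightarrow> length C \<le> length ys)"
    using assms by (intro ex_has_least_nat[of _ xs]) simp
  then show ?thesis using that by (auto simp: min_odd_cwalk_def)
qed

text \<open>A repeated vertex splits the walk into two shorter closed walks, one of which is
  odd.\<close>

lemma min_odd_cwalk_distinct:
  assumes "min_odd_cwalk E C"
  shows "distinct C"
proof (rule ccontr)
  assume "\<not> distinct C"
  then obtain A B D y where C: "C = A @ [y] @ B @ [y] @ D"
    using not_distinct_decomp by blast
  have "cwalk E C" using assms by (simp add: min_odd_cwalk_def)
  then have "cwalk E (y # B)" "cwalk E (A @ y # D)"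
    unfolding C by (auto simp: cwalk_def successively_append_iff successively_Cons hd_append
        split: if_splits)
  then have "odd (length (y # B)) \<longrightarrow> length C \<le> length (y # B)"
    "odd (length (A @ y # D)) \<longrightarrow> length C \<le> length (A @ y # D)" "odd (length C)"
    using assms by (auto simp: min_odd_cwalk_def)
  then show False using C by auto
qed

lemma min_odd_cwalk_length:
  assumes "min_odd_cwalk E C" "irreflp E"
  shows "3 \<le> length C"
proof -
  have "length C \<noteq> 1"
  proof
    assume "length C = 1"
    then obtain x where "C = [x]" by (auto simp: length_Suc_conv)
    then show False using assms by (auto simp: min_odd_cwalk_def cwalk_def irreflp_def)
  qed
  moreover have "odd (length C)" using assms(1) by (simp add: min_odd_cwalk_def)
  ultimately show ?thesis by (cases "length C = 2") (auto elim: oddE)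
qed

text \<open>A chord closes both arcs. The two lengths add up to an odd number, so one of them is
  odd, and both are shorter than the walk if neither arc is empty.\<close>

lemma min_odd_cwalk_chord:
  assumes "min_odd_cwalk E (x # A @ y # B)" "symp E" "E x y"
  shows "A = [] \<or> B = []"
proof (rule ccontr)
  assume ne: "\<not> (A = [] \<or> B = [])"
  have "E y x" using assms(2,3) by (rule sympD)
  moreover have "cwalk E (x # A @ y # B)" using assms(1) by (simp add: min_odd_cwalk_def)
  ultimately have "cwalk E (x # A @ [y])" "cwalk E (x # y # B)"
    using assms(3) ne by (simp_all add: cwalk_def successively_append_iff successively_Cons)
  then have "odd (length (x # A @ [y])) \<longrightarrow> length (x # A @ y # B) \<le> length (x # A @ [y])"
    "odd (length (x # y # B)) \<longrightarrow> length (x # A @ y # B) \<le> length (x # y # B)"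
    "odd (length (x # A @ y # B))"
    using assms(1) unfolding min_odd_cwalk_def by blast+
  then show False using ne by (cases A; cases B) auto
qed

text \<open>Going through \<open>u\<close> closes either arc. Exactly one of the two closed walks is
  odd, and minimality then leaves at most one inner vertex on the other arc; parity makes it exactly
  one.\<close>

lemma min_odd_cwalk_two_neighbours:
  assumes "min_odd_cwalk E (x # A @ y # B)" "symp E" "E u x" "E u y"
  shows "length A = 1 \<and> even (length B) \<or> length B = 1 \<and> even (length A)"
proof -
  have "E y u" "E x u" using assms(2-4) by (auto dest: sympD)
  moreover have "cwalk E (x # A @ y # B)" using assms(1) by (simp add: min_odd_cwalk_def)
  ultimately have "cwalk E (u # x # A @ [y])" "cwalk E (u # y # B @ [x])"
    using assms(3,4) by (auto simp add: cwalk_def successively_append_iff successively_Cons hd_append)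
  then have "odd (length (u # x # A @ [y])) \<longrightarrow> length (x # A @ y # B) \<le> length (u # x # A @ [y])"
    "odd (length (u # y # B @ [x])) \<longrightarrow> length (x # A @ y # B) \<le> length (u # y # B @ [x])"
    "odd (length (x # A @ y # B))"
    using assms(1) unfolding min_odd_cwalk_def by blast+
  then show ?thesis by (auto simp: le_Suc_eq)
qed

text \<open>The two arcs of an odd cycle have opposite parity.\<close>

lemma odd_cycle_both_parities:
  assumes "min_odd_cwalk E C" "symp E" "v \<in> set C" "v' \<in> set C" "v \<noteq> v'"
  shows "\<exists>q. upath E (set C) v v' q \<and> even (length q) = P"
proof -
  obtain A B where AB: "min_odd_cwalk E (v # A @ v' # B)" "distinct (v # A @ v' # B)"
    "set C = set (v # A @ v' # B)"
    using min_odd_cwalk_split[OF assms(1) min_odd_cwalk_distinct[OF assms(1)] assms(3-5)] by blast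
  have cw: "cwalk E (v # A @ v' # B)" and odd: "odd (length (v # A @ v' # B))"
    using AB(1) by (simp_all add: min_odd_cwalk_def)
  have "upath E (set C) v v' (v # A @ [v'])"
    using AB(2,3) cw
    by (auto simp: upath_def cwalk_def successively_append_iff successively_Cons hd_append)
  moreover have "upath E (set C) v' v (v' # B @ [v])"
    using AB(2,3) cw
    by (auto simp: upath_def cwalk_def successively_append_iff successively_Cons hd_append)
  then have "upath E (set C) v v' (rev (v' # B @ [v]))"
    using assms(2) by (rule upath_rev[rotated])
  moreover have "even (length (v # A @ [v'])) \<noteq> even (length (rev (v' # B @ [v])))"
    using odd by auto
  ultimately show ?thesis by metis
qed

text \<open>The paths share only \<open>v\<close>, which \<open>tl\<close> drops from the second
  one; the edge from \<open>v'\<close> to \<open>x\<close> closes the cycle.\<close>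

lemma ucycle_join:
  assumes "upath E S x v p" "upath E X v v' q" "S \<inter> X = {v}" "E v' x" "x \<noteq> v" "v \<noteq> v'"
  shows "ucycle E (p @ tl q)" "length (p @ tl q) = length p + length q - 1"
proof -
  obtain q' where q: "q = v # q'" using assms(2) by (cases q) (auto simp: upath_def)
  have q': "q' \<noteq> []" "last q' = v'" "E v (hd q')" "successively E q'" "distinct q'" "v \<notin> set q'"
    "set q' \<subseteq> X"
    using assms(2,6) q by (auto simp: upath_def successively_Cons split: if_splits)
  obtain p' where p: "p = x # p'" "p' \<noteq> []"
    using assms(1,5) by (cases p) (auto simp: upath_def split: if_splits)
  have "set p \<subseteq> S" using assms(1) by (simp add: upath_def)
  then have "set p \<inter> set q' \<subseteq> S \<inter> X - {v}" using q'(6,7) by blast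
  then have "set p \<inter> set q' = {}" using assms(3) by simp
  moreover have "cwalk E (p @ q')"
    using assms(1,4) q' by (auto simp: cwalk_def upath_def successively_append_iff)
  moreover have "3 \<le> length (p @ q')"
    using p q'(1) by (cases p'; cases q') auto
  ultimately show "ucycle E (p @ tl q)"
    using assms(1) q q' by (auto simp: ucycle_def upath_def)
  show "length (p @ tl q) = length p + length q - 1" using q by simp
qed

section \<open>Graphs that are 3-connected with minimum degree at least four\<close>

text \<open>Connectivity is stated through boundaries: if vertices remain beyond the boundary of
  \<open>K\<close>, this boundary separates them from \<open>K\<close>.\<close>

locale three_connected_graph =
  fixes V :: "'a set" and E :: "'a \<Rightarrow> 'a \<Rightarrow> bool"
  assumes fin: "finite V" and sym: "symp E" and irr: "irreflp E"
    and edge_in: "E u v \<Longrightarrow> u \<in> V"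
    and deg: "v \<in> V \<Longrightarrow> 4 \<le> card {u \<in> V. E v u}"
    and three_conn: "K \<subseteq> V \<Longrightarrow> K \<noteq> {} \<Longrightarrow> V - K - boundary V E K \<noteq> {} \<Longrightarrow>
      3 \<le> card (boundary V E K)"
begin

lemma E_sym: "E u v \<longleftrightarrow> E v u"
  using sym by (meson sympD)

lemma E_irr [simp]: "\<not> E u u"
  using irr by (rule irreflpD)

lemma edge_in': "E u v \<Longrightarrow> v \<in> V"
  using edge_in E_sym by blast

text \<open>Contracting \<open>X - {v}\<close> to \<open>j\<close> makes \<open>L\<close> a rooted
  graph. The two resulting paths to \<open>v\<close> start at the same \<open>x\<close>, hence can
  be closed by the same path in \<open>X\<close>.\<close>

lemma consecutive_odd_cycles_attached:
  assumes X: "v \<in> X" "X \<subseteq> V" and L: "L \<subseteq> V - X" "conn E L"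
    and closed: "\<And>k u. k \<in> L \<Longrightarrow> E k u \<Longrightarrow> u \<in> L \<union> X"
    and k\<^sub>1: "k\<^sub>1 \<in> L" "E k\<^sub>1 v" and k\<^sub>2: "k\<^sub>2 \<in> L" "j \<in> X - {v}" "E k\<^sub>2 j"
    and uniq: "\<And>k i j. k \<in> L \<Longrightarrow> i \<in> X - {v} \<Longrightarrow> j \<in> X - {v} \<Longrightarrow> E k i \<Longrightarrow> E k j \<Longrightarrow> i = j"
    and par: "\<And>v' P. v' \<in> X - {v} \<Longrightarrow> \<exists>q. upath E X v v' q \<and> even (length q) = P"
  shows "consecutive_odd_cycles E"
proof -
  have jL: "j \<notin> L" and vL: "v \<notin> L" and vj: "v \<noteq> j" using k\<^sub>2 X L by auto
  let ?E = "contraction E L X v j"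
  have LV: "L \<subseteq> V" and vV: "v \<in> V" using L X by blast+
  have bd: "2 \<le> card (boundary V E K')" if K': "K' \<subset> L" "K' \<noteq> {}" for K'
  proof -
    have fin': "finite (boundary V E K')" using fin by (simp add: boundary_def)
    \<comment> \<open>If nothing lies beyond the boundary, it contains both \<open>j\<close> and
      \<open>v\<close>.\<close>
    show ?thesis
    proof (cases "V - K' - boundary V E K' = {}")
      case True
      then have "j \<in> boundary V E K'" "v \<in> boundary V E K'" using k\<^sub>2 X K' L by auto
      then show ?thesis using two_le_cardI[OF fin'] vj by blast
    next
      case False
      moreover have "K' \<subseteq> V" using K' LV by blast
      ultimately have "3 \<le> card (boundary V E K')" using three_conn K'(2) by blast
      then show ?thesis by simp
    qed
  qed
  have closed': "u \<in> L \<union> {v} \<union> X" if "k \<in> L" "u \<in> V" "E k u" for k u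
    using closed[OF that(1,3)] by blast
  have degL: "4 \<le> card {u \<in> V. E k u}" if "k \<in> L" for k
    using that LV by (intro deg) blast
  have "rooted (insert v (insert j L)) ?E v j"
    by (rule rooted_contraction[OF fin sym irr LV L(2) vL jL vj vV closed' k\<^sub>1 k\<^sub>2 bd degL uniq])
  \<comment> \<open>The roots are exchanged so that the shared first edge leaves the contracted
    set.\<close>
  then have "rooted (insert v (insert j L)) ?E j v"
    by (rule rooted_commute[THEN iffD1])
  from rooted_two_paths[OF this]
  obtain x where x: "?E j x" "two_paths ?E (insert v (insert j L) - {j}) x v"
    by blast
  have xL: "x \<in> L" and "\<exists>i \<in> X - {v}. E x i" using x(1) jL vj by (auto simp: contraction_def)
  then obtain v' where v': "v' \<in> X - {v}" "E v' x" using E_sym by blast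
  have path: "upath E (insert v L) x v p"
    if "upath ?E (insert v (insert j L) - {j}) x v p" for p
  proof -
    have "set p \<subseteq> insert v L" using that jL by (auto simp: upath_def)
    moreover have "successively E p"
      using that unfolding upath_def
      by (elim conjE, elim successively_mono) (auto simp: contraction_def)
    ultimately show ?thesis using that by (auto simp: upath_def)
  qed
  obtain p p' where p: "upath E (insert v L) x v p" "upath E (insert v L) x v p'"
    "length p' = length p + 2"
    using x(2) path unfolding two_paths_def by blast
  \<comment> \<open>The joined cycle has \<open>length p + length q - 1\<close> vertices, which is
    odd when the two lengths have equal parity.\<close>
  obtain q where q: "upath E X v v' q" "even (length q) = even (length p)"
    using par[OF v'(1)] by blast
  have disj: "insert v L \<inter> X = {v}" and "x \<noteq> v" "v \<noteq> v'" using X L v' xL by auto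
  note join = ucycle_join[OF _ q(1) disj v'(2) this(2,3)]
  have "length p > 0" "length q > 0" using p(1) q(1) by (auto simp: upath_def)
  then have "odd (length (p @ tl q))" "length (p' @ tl q) = length (p @ tl q) + 2"
    using join(2)[OF p(1)] join(2)[OF p(2)] p(3) q(2) by presburger+
  then show ?thesis
    using join(1)[OF p(1)] join(1)[OF p(2)] unfolding consecutive_odd_cycles_def by blast
qed

text \<open>Either every vertex of \<open>X\<close> is attached to \<open>L\<close>, or the boundary
  separates \<open>L\<close> from an unattached one.\<close>

lemma component_boundary:
  assumes X: "X \<subseteq> V" "3 \<le> card X" and k: "k \<in> V - X"
  defines "L \<equiv> component_of E (V - X) k"
  shows "L \<subseteq> V - X" "k \<in> L" "conn E L" "\<And>k u. k \<in> L \<Longrightarrow> E k u \<Longrightarrow> u \<in> L \<union> X"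
    "boundary V E L \<subseteq> X" "3 \<le> card (boundary V E L)"
proof -
  show L: "L \<subseteq> V - X" "k \<in> L" "conn E L"
    unfolding L_def using k sym
    by (simp_all add: component_of_self conn_component_of component_of_subset)
  show closed: "u \<in> L \<union> X" if "k \<in> L" "E k u" for k u
    using component_of_closed[of k E "V - X" _ u] that edge_in'[of k u] unfolding L_def by blast
  show sub: "boundary V E L \<subseteq> X"
    using closed by (auto simp: boundary_def)
  show "3 \<le> card (boundary V E L)"
  proof (cases "V - L - boundary V E L = {}")
    case True
    then have "boundary V E L = X" using sub X L by auto
    then show ?thesis using X by simp
  next
    case False
    then show ?thesis using three_conn L by blast
  qed
qed

lemma boundary_other:
  assumes "3 \<le> card (boundary V E L)"
  obtains k j where "k \<in> L" "E k j" "j \<in> boundary V E L" "j \<noteq> v"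
proof -
  have "2 \<le> card (boundary V E L)" using assms by simp
  then obtain j where "j \<in> boundary V E L" "j \<noteq> v" by (rule two_le_cardE)
  then show ?thesis using that by (auto simp: boundary_def)
qed

text \<open>This reduces the search to an attachment vertex \<open>v\<close> such that no vertex of
  the component sees two vertices of \<open>X - {v}\<close>.\<close>

lemma consecutive_odd_cycles_component:
  assumes X: "X \<subseteq> V" "3 \<le> card X" and k: "k \<in> V - X"
    and v: "v \<in> boundary V E (component_of E (V - X) k)"
    and uniq: "\<And>k' i j. k' \<in> component_of E (V - X) k \<Longrightarrow> i \<in> X - {v} \<Longrightarrow> j \<in> X - {v} \<Longrightarrow>
      E k' i \<Longrightarrow> E k' j \<Longrightarrow> i = j"
    and par: "\<And>v' P. v' \<in> X - {v} \<Longrightarrow> \<exists>q. upath E X v v' q \<and> even (length q) = P"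
  shows "consecutive_odd_cycles E"
proof -
  let ?L = "component_of E (V - X) k"
  note L = component_boundary[OF X k]
  obtain k\<^sub>1 where k\<^sub>1: "k\<^sub>1 \<in> ?L" "E k\<^sub>1 v" using v by (auto simp: boundary_def)
  obtain k\<^sub>2 j where k\<^sub>2: "k\<^sub>2 \<in> ?L" "E k\<^sub>2 j" "j \<in> boundary V E ?L" "j \<noteq> v"
    using boundary_other[OF L(6)] by metis
  have vX: "v \<in> X" and jX: "j \<in> X - {v}" using v k\<^sub>2 L(5) by blast+
  show ?thesis
    by (rule consecutive_odd_cycles_attached[OF vX X(1) L(1,3,4) k\<^sub>1 k\<^sub>2(1) jX k\<^sub>2(2) uniq par])
qed

section \<open>Graphs containing a triangle\<close>

lemma clique_both_parities:
  assumes clique: "\<And>i j. i \<in> X \<Longrightarrow> j \<in> X \<Longrightarrow> i \<noteq> j \<Longrightarrow> E i j"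
    and X: "3 \<le> card X" "v \<in> X" "v' \<in> X - {v}"
  shows "\<exists>q. upath E X v v' q \<and> even (length q) = P"
proof -
  have "\<not> X \<subseteq> {v, v'}"
    using X(1) card_mono[of "{v, v'}" X] by (auto simp: card_insert_if split: if_splits)
  then obtain w where w: "w \<in> X" "w \<noteq> v" "w \<noteq> v'" by blast
  have "upath E X v v' [v, v']" "upath E X v v' [v, w, v']"
    using w X clique by (auto simp: upath_def)
  moreover have "even (length [v, v'])" "odd (length [v, w, v'])" by simp_all
  ultimately show ?thesis by (cases P) blast+
qed

lemma ex_outside_clique:
  assumes "a \<in> X" "X \<subseteq> V" "card X \<le> 4"
  obtains k where "k \<in> V - X"
proof -
  have "\<not> {u \<in> V. E a u} \<subseteq> X - {a}"
  proof
    assume "{u \<in> V. E a u} \<subseteq> X - {a}"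
    moreover have "finite X" using assms(2) fin by (rule finite_subset)
    ultimately have "card {u \<in> V. E a u} \<le> card (X - {a})" by (intro card_mono) auto
    also have "\<dots> < card X" using \<open>finite X\<close> assms(1) by (intro card_Diff1_less) auto
    finally show False using deg[of a] assms by auto
  qed
  then show ?thesis using that by auto
qed

lemma consecutive_odd_cycles_triangle:
  assumes tri: "E a b" "E b c" "E c a"
  shows "consecutive_odd_cycles E"
proof (rule ccontr)
  assume no: "\<not> consecutive_odd_cycles E"
  have abc: "a \<noteq> b" "b \<noteq> c" "a \<noteq> c" using tri E_irr by auto
  \<comment> \<open>Given the triangle, any cycle of length five would finish the proof.\<close>
  have "ucycle E [a, b, c]" using tri abc by (auto simp: ucycle_def cwalk_def)
  moreover have "odd (length [a, b, c])" "length [a, b, c] + 2 = 5" by simp_all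
  ultimately have no5: "\<not> ucycle E xs" if "length xs = 5" for xs
    using no that unfolding consecutive_odd_cycles_def by metis
  have no5': False
    if "distinct [v\<^sub>1, v\<^sub>2, v\<^sub>3, v\<^sub>4, v\<^sub>5]" "E v\<^sub>1 v\<^sub>2" "E v\<^sub>2 v\<^sub>3" "E v\<^sub>3 v\<^sub>4" "E v\<^sub>4 v\<^sub>5" "E v\<^sub>5 v\<^sub>1"
    for v\<^sub>1 v\<^sub>2 v\<^sub>3 v\<^sub>4 v\<^sub>5
    using no5[of "[v\<^sub>1, v\<^sub>2, v\<^sub>3, v\<^sub>4, v\<^sub>5]"] that by (auto simp: ucycle_def cwalk_def)
  have V: "a \<in> V" "b \<in> V" "c \<in> V" using tri edge_in by blast+
  have sym_abc: "E b a" "E c b" "E a c" using tri E_sym by blast+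
  show False
  proof (cases "\<exists>u. E u a \<and> E u b \<and> E u c")
    case True
    then obtain u where u: "E u a" "E u b" "E u c" by blast
    define X where "X = {a, b, c, u}"
    have uabc: "u \<noteq> a" "u \<noteq> b" "u \<noteq> c" using u E_irr by auto
    have card: "card X = 4" using abc uabc by (simp add: X_def)
    have XV: "X \<subseteq> V" using V u edge_in by (auto simp: X_def)
    have "E a u" "E b u" "E c u" using u E_sym by blast+
    then have clique: "E i j" if "i \<in> X" "j \<in> X" "i \<noteq> j" for i j
      using that u tri sym_abc unfolding X_def by blast
    obtain k where k: "k \<in> V - X" using ex_outside_clique[of a X] XV card by (auto simp: X_def)
    let ?L = "component_of E (V - X) k"
    note L = component_boundary[OF XV _ k]
    obtain v where v: "v \<in> boundary V E ?L" using L(6) card by fastforce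
    have vX: "v \<in> X" using v L(5) card by auto
    \<comment> \<open>An outside vertex with two neighbours in the clique closes a 5-cycle through
      all four clique vertices.\<close>
    have "i = j" if ij: "k' \<in> ?L" "i \<in> X" "j \<in> X" "E k' i" "E k' j" for k' i j
    proof (rule ccontr)
      assume "i \<noteq> j"
      then have "card (X - {i, j}) = 2"
        using card ij XV fin by (simp add: card_Diff_subset finite_subset)
      then obtain s t where st: "X - {i, j} = {s, t}" "s \<noteq> t" by (auto simp: card_2_iff)
      then have "s \<in> X" "t \<in> X" "s \<noteq> i" "s \<noteq> j" "t \<noteq> i" "t \<noteq> j" by blast+
      moreover have "k' \<notin> X" using ij(1) L(1) card by auto
      ultimately have "distinct [k', i, s, t, j]" "E i s" "E s t" "E t j"
        using ij \<open>i \<noteq> j\<close> st(2) clique by auto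
      moreover have "E j k'" using ij E_sym by blast
      ultimately show False using no5' ij(4) by blast
    qed
    then have "consecutive_odd_cycles E"
      using consecutive_odd_cycles_component[OF XV _ k v] clique_both_parities[OF clique _ vX] card
      by auto
    then show False using no by blast
  next
    case False
    define X where "X = {a, b, c}"
    have card: "card X = 3" using abc by (simp add: X_def)
    have XV: "X \<subseteq> V" using V by (auto simp: X_def)
    have clique: "E i j" if "i \<in> X" "j \<in> X" "i \<noteq> j" for i j
      using that tri sym_abc unfolding X_def by blast
    obtain k where k: "k \<in> V - X" using ex_outside_clique[of a X] XV card by (auto simp: X_def)
    let ?L = "component_of E (V - X) k"
    note L = component_boundary[OF XV _ k]
    \<comment> \<open>If some \<open>u\<close> sees \<open>i\<close> and \<open>j\<close>, take
      \<open>v = j\<close>. A vertex seeing \<open>i\<close> and the third vertex \<open>t\<close>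
      is either \<open>u\<close>, giving the excluded clique, or different from \<open>u\<close>,
      giving a 5-cycle.\<close>
    have "\<exists>v \<in> boundary V E ?L. \<forall>k' \<in> ?L. \<forall>i \<in> X - {v}. \<forall>j \<in> X - {v}. E k' i \<longrightarrow> E k' j \<longrightarrow> i = j"
    proof (cases "\<exists>u \<in> ?L. \<exists>i \<in> X. \<exists>j \<in> X. i \<noteq> j \<and> E u i \<and> E u j")
      case True
      then obtain u i j where u: "u \<in> ?L" "i \<in> X" "j \<in> X" "i \<noteq> j" "E u i" "E u j" by blast
      have "card (X - {i, j}) = 1"
        using card u XV fin by (simp add: card_Diff_subset finite_subset)
      then obtain t where t: "X - {i, j} = {t}" by (auto simp: card_1_singleton_iff)
      then have tX: "t \<in> X" "t \<noteq> i" "t \<noteq> j" and X: "X = {i, j, t}" using u by blast+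
      have jbd: "j \<in> boundary V E ?L" using u L(1) card XV by (auto simp: boundary_def)
      have "\<not> (E k' i \<and> E k' t)" if k': "k' \<in> ?L" for k'
      proof
        assume *: "E k' i \<and> E k' t"
        show False
        proof (cases "k' = u")
          case True
          then have "\<forall>w \<in> X. E u w" using * u X by blast
          then show False using False \<open>\<not> (\<exists>u. E u a \<and> E u b \<and> E u c)\<close> by (auto simp: X_def)
        next
          case False
          have "k' \<notin> X" "u \<notin> X" using k' u(1) L(1) card by auto
          then have "distinct [u, i, k', t, j]" using False u tX by auto
          moreover have "E i k'" "E t j" "E j u" using * u E_sym clique tX by blast+
          ultimately show False using no5' * u(5) by blast
        qed
      qed
      then show ?thesis using jbd X by (intro bexI[of _ j]) auto
    next
      case False
      moreover obtain v where "v \<in> boundary V E ?L" using L(6) card by fastforce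
      ultimately show ?thesis by blast
    qed
    then obtain v where v: "v \<in> boundary V E ?L"
      and uniq: "\<And>k' i j. k' \<in> ?L \<Longrightarrow> i \<in> X - {v} \<Longrightarrow> j \<in> X - {v} \<Longrightarrow> E k' i \<Longrightarrow> E k' j \<Longrightarrow> i = j"
      by blast
    have vX: "v \<in> X" using v L(5) card by auto
    have X3: "3 \<le> card X" using card by simp
    have "consecutive_odd_cycles E"
      by (rule consecutive_odd_cycles_component[OF XV X3 k v uniq clique_both_parities[OF clique X3 vX]])
    then show False using no by blast
  qed
qed

section \<open>Shortest odd cycles of length at least five\<close>

lemma consecutive_odd_cycles_long:
  assumes C: "min_odd_cwalk E C" and len: "5 \<le> length C"
  shows "consecutive_odd_cycles E"
proof -
  have dist: "distinct C" using C by (rule min_odd_cwalk_distinct)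
  have cw: "cwalk E C" using C by (simp add: min_odd_cwalk_def)
  define X where "X = set C"
  have card: "3 \<le> card X" using len dist by (simp add: X_def distinct_card)
  have XV: "X \<subseteq> V"
  proof
    fix x assume "x \<in> X"
    then obtain P Q where PQ: "C = P @ x # Q" unfolding X_def by (meson split_list)
    then have "E x (hd (Q @ [hd C]))"
      using cw by (cases Q) (auto simp: cwalk_def successively_append_iff)
    then show "x \<in> V" by (rule edge_in)
  qed
  obtain v\<^sub>0 D where C': "C = v\<^sub>0 # D" using len by (cases C) auto
  \<comment> \<open>Without chords \<open>v\<^sub>0\<close> has at most two neighbours on the cycle,
    so its degree forces a vertex outside.\<close>
  have "{u \<in> X. E v\<^sub>0 u} \<subseteq> {hd D, last D}"
  proof
    fix y assume y: "y \<in> {u \<in> X. E v\<^sub>0 u}"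
    then have "y \<in> set D" using C' E_irr by (auto simp: X_def)
    then obtain A B where D: "D = A @ y # B" by (meson split_list)
    then have "A = [] \<or> B = []" using min_odd_cwalk_chord[of E v\<^sub>0 A y B] C C' sym y by auto
    then show "y \<in> {hd D, last D}" using D by auto
  qed
  then have "card {u \<in> X. E v\<^sub>0 u} \<le> card {hd D, last D}" by (intro card_mono) auto
  also have "\<dots> \<le> 2" by (simp add: card_insert_if)
  finally have "card {u \<in> X. E v\<^sub>0 u} \<le> 2" .
  moreover have "v\<^sub>0 \<in> V" using XV C' by (auto simp: X_def)
  ultimately have "X \<noteq> V" using deg[of v\<^sub>0] by auto
  then obtain k where k: "k \<in> V - X" using XV by blast
  let ?L = "component_of E (V - X) k"
  note L = component_boundary[OF XV card k]
  note component = consecutive_odd_cycles_component[OF XV card k]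
  have par: "\<exists>q. upath E X v v' q \<and> even (length q) = P" if "v \<in> X" "v' \<in> X - {v}" for v v' P
    using odd_cycle_both_parities[OF C sym, of v v' P] that by (auto simp: X_def)
  show ?thesis
  proof (cases "\<exists>u \<in> ?L. \<exists>i \<in> X. \<exists>j \<in> X. i \<noteq> j \<and> E u i \<and> E u j")
    case False
    obtain v where v: "v \<in> boundary V E ?L" using L(6) by fastforce
    show ?thesis
      by (rule component[OF v]) (use False par v L(5) in \<open>blast+\<close>)
  next
    case True
    then obtain u i j where u: "u \<in> ?L" and ij: "i \<in> X" "j \<in> X" "i \<noteq> j" "E u i" "E u j" by blast
    \<comment> \<open>The neighbours \<open>x\<close> and \<open>y\<close> of \<open>u\<close> are
      at distance two on the cycle; the cycle is rotated so that \<open>m\<close> lies between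
      them.\<close>
    obtain y m x A where A: "min_odd_cwalk E (y # m # x # A)" "set C = set (y # m # x # A)"
      and ux: "E u x" and uy: "E u y"
    proof -
      obtain A B where AB: "min_odd_cwalk E (i # A @ j # B)" "set C = set (i # A @ j # B)"
        using min_odd_cwalk_split[OF C dist] ij unfolding X_def by metis
      consider "length A = 1" | "length B = 1"
        using min_odd_cwalk_two_neighbours[OF AB(1) sym ij(4,5)] by blast
      then show ?thesis
      proof cases
        case 1
        then obtain m where "A = [m]" by (auto simp: length_Suc_conv)
        then show ?thesis using that[of i m j B] AB ij by simp
      next
        case 2
        then obtain m where B: "B = [m]" by (auto simp: length_Suc_conv)
        have "min_odd_cwalk E ((j # [m]) @ i # A)"
          using min_odd_cwalk_rotate[of E "i # A" "j # [m]"] AB(1) B by simp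
        then show ?thesis using that[of j m i A] AB(2) B ij by auto
      qed
    qed
    have dA: "distinct (y # m # x # A)" using A(1) by (rule min_odd_cwalk_distinct)
    have cwA: "cwalk E (y # m # x # A)" and evA: "even (length A)"
      using A(1) by (simp_all add: min_odd_cwalk_def)
    have X: "X = set (y # m # x # A)" using A(2) by (simp add: X_def)
    have Eym: "E y m" "E m y" and Emx: "E m x" "E x m" using cwA E_sym by (auto simp: cwalk_def)
    show ?thesis
    proof (cases "\<exists>w \<in> ?L - {u}. \<exists>j \<in> set A. E w j")
      case True
      then obtain w j where w: "w \<in> ?L" "w \<noteq> u" and j: "j \<in> set A" "E w j" by blast
      obtain A\<^sub>1 A\<^sub>2 where A12: "A = A\<^sub>1 @ j # A\<^sub>2" using j(1) by (meson split_list)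
      obtain p where p: "upath E ?L u w p" using conn_imp_upath[OF L(3) u w(1)] by blast
      have jX: "j \<in> X" using j X by auto
      have jL: "j \<notin> ?L" using jX L(1) by blast
      have uj: "u \<noteq> j" using u jL by blast
      have pj: "upath E (insert j ?L) u j (p @ [j])"
        using upath_append[OF p, of "{j}" j j "[j]"] j jL by simp
      have disj: "insert j ?L \<inter> X = {j}" using L(1) jX by blast
      have xy: "x \<in> X" "y \<in> X" "j \<noteq> x" "j \<noteq> y" using X dA j(1) by auto
      have sucA: "successively E (y # m # x # A\<^sub>1 @ [j])" "successively E (j # A\<^sub>2 @ [y, m, x])"
        using cwA Eym Emx A12
        by (auto simp: cwalk_def successively_append_iff successively_Cons hd_append)
      have up1: "upath E X x j (x # A\<^sub>1 @ [j])" "upath E X y j (y # m # x # A\<^sub>1 @ [j])"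
        using sucA(1) dA X A12 by (auto simp: upath_def)
      have up2: "upath E X j y (j # A\<^sub>2 @ [y])" "upath E X j x (j # A\<^sub>2 @ [y, m, x])"
        using sucA(2) dA X A12
        by (auto simp: upath_def successively_append_iff successively_Cons hd_append)
      note join_x = ucycle_join[OF pj _ disj _ uj xy(3)] and join_y = ucycle_join[OF pj _ disj _ uj xy(4)]
      have Exu: "E x u" "E y u" using ux uy E_sym by blast+
      show ?thesis
      \<comment> \<open>From \<open>j\<close> one returns to \<open>u\<close> along either arc,
        ending at the first of \<open>x\<close>, \<open>y\<close> met or two steps later at the
        other. As \<open>A\<close> has even length, one of the two arcs gives odd cycles.\<close>
      proof (cases "odd (length p + length A\<^sub>1)")
        case True
        note c1 = join_x[OF upath_rev[OF sym up1(1)] Exu(1)]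
        note c2 = join_y[OF upath_rev[OF sym up1(2)] Exu(2)]
        have "odd (length ((p @ [j]) @ tl (rev (x # A\<^sub>1 @ [j]))))"
          using True by simp
        moreover have "length ((p @ [j]) @ tl (rev (y # m # x # A\<^sub>1 @ [j]))) =
            length ((p @ [j]) @ tl (rev (x # A\<^sub>1 @ [j]))) + 2"
          by simp
        ultimately show ?thesis
          unfolding consecutive_odd_cycles_def using c1(1) c2(1) by blast
      next
        case False
        note c1 = join_y[OF up2(1) Exu(2)]
        note c2 = join_x[OF up2(2) Exu(1)]
        have "odd (length ((p @ [j]) @ tl (j # A\<^sub>2 @ [y])))"
          using False evA A12 by simp
        moreover have "length ((p @ [j]) @ tl (j # A\<^sub>2 @ [y, m, x])) =
            length ((p @ [j]) @ tl (j # A\<^sub>2 @ [y])) + 2"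
          by simp
        ultimately show ?thesis
          unfolding consecutive_odd_cycles_def using c1(1) c2(1) by blast
      qed
    next
      case noA: False
      \<comment> \<open>Applied to \<open>x\<close> and \<open>j\<close>, minimality makes
        \<open>A\<^sub>1\<close> a single vertex; applied to \<open>y\<close> and \<open>j\<close>,
        it makes its length even.\<close>
      have "\<not> E u j" if jA: "j \<in> set A" for j
      proof
        assume uj: "E u j"
        obtain A\<^sub>1 A\<^sub>2 where A12: "A = A\<^sub>1 @ j # A\<^sub>2" using jA by (meson split_list)
        have "min_odd_cwalk E ((x # A\<^sub>1 @ j # A\<^sub>2) @ [y, m])"
          using min_odd_cwalk_rotate[of E "[y, m]" "x # A\<^sub>1 @ j # A\<^sub>2"] A(1) A12 by simp
        then have "length A\<^sub>1 = 1"
          using min_odd_cwalk_two_neighbours[of E x A\<^sub>1 j "A\<^sub>2 @ [y, m]" u] sym ux uj by auto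
        moreover have "even (length A\<^sub>1)"
          using min_odd_cwalk_two_neighbours[of E y "m # x # A\<^sub>1" j A\<^sub>2 u] A(1) A12 sym uy uj by auto
        ultimately show False by simp
      qed
      then have bd: "j \<in> {x, m, y}" if "k' \<in> ?L" "j \<in> X" "E k' j" for k' j
        using noA that X by (cases "k' = u") auto
      have yX: "y \<in> X" using X by simp
      have ybd: "y \<in> boundary V E ?L"
        using u uy yX XV L(1) by (auto simp: boundary_def)
      \<comment> \<open>With \<open>v = y\<close> only \<open>x\<close> and \<open>m\<close> remain
        as attachments; seeing both would close a triangle, shorter than \<open>C\<close>.\<close>
      have no_tri: "\<not> (E k' x \<and> E k' m)" for k'
      proof
        assume "E k' x \<and> E k' m"
        then have "cwalk E [k', m, x]" using Emx E_sym by (auto simp: cwalk_def)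
        then have "length C \<le> length [k', m, x]" using C unfolding min_odd_cwalk_def by force
        then show False using len by simp
      qed
      show ?thesis
      proof (rule component[OF ybd])
        fix k' i j assume "k' \<in> ?L" "i \<in> X - {y}" "j \<in> X - {y}" "E k' i" "E k' j"
        then have "i \<in> {x, m}" "j \<in> {x, m}" "E k' i" "E k' j" using bd by blast+
        then show "i = j" using no_tri[of k'] by blast
      qed (use par yX in blast)
    qed
  qed
qed

section \<open>Existence of an odd closed walk\<close>

lemma conn_V: "conn E V"
proof -
  have "component_of E V s = V" if s: "s \<in> V" for s
  proof (rule ccontr)
    let ?K = "component_of E V s"
    assume "?K \<noteq> V"
    moreover have KV: "?K \<subseteq> V" by (rule component_of_subset)
    moreover have ne: "?K \<noteq> {}" using component_of_self[OF s, of E] by blast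
    moreover have bd: "boundary V E ?K = {}"
      unfolding boundary_def by (blast intro: component_of_closed)
    ultimately show False using three_conn[OF KV ne] by auto
  qed
  then have "linked E V s t" if "s \<in> V" "t \<in> V" for s t
    using that by (auto simp: component_of_def)
  then show ?thesis by (simp add: conn_def)
qed

text \<open>Vertices are coloured by the parity of walks from \<open>s\<close>; without odd closed
  walks this colouring is a bipartition.\<close>

lemma ex_odd_cwalk:
  assumes nonbip: "\<And>A B. A \<union> B = V \<Longrightarrow> A \<inter> B = {} \<Longrightarrow>
      \<exists>u v. E u v \<and> \<not> (u \<in> A \<and> v \<in> B \<or> u \<in> B \<and> v \<in> A)"
  shows "\<exists>xs. cwalk E xs \<and> odd (length xs)"
proof (rule ccontr)
  assume no: "\<nexists>xs. cwalk E xs \<and> odd (length xs)"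
  obtain s where s: "s \<in> V" using nonbip[of "{}" "{}"] edge_in by auto
  define W where "W v p \<longleftrightarrow> p \<noteq> [] \<and> hd p = s \<and> last p = v \<and> successively E p" for v p
  define A where "A = {v \<in> V. \<exists>p. W v p \<and> even (length p)}"
  define B where "B = {v \<in> V. \<exists>p. W v p \<and> odd (length p)}"
  have "\<exists>p. W v p" if "v \<in> V" for v
    using conn_imp_upath[OF conn_V s that] by (auto simp: W_def upath_def)
  then have "A \<union> B = V" by (auto simp: A_def B_def)
  moreover have "A \<inter> B = {}"
  proof (rule ccontr)
    assume "A \<inter> B \<noteq> {}"
    then obtain v p q where p: "W v p" "even (length p)" and q: "W v q" "odd (length q)"
      by (auto simp: A_def B_def)
    obtain p' where p': "p = p' @ [v]" using p(1) unfolding W_def by (metis append_butlast_last_id)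
    obtain q' where q': "q = s # q'" using q(1) unfolding W_def by (metis list.collapse)
    have p'ne: "p' \<noteq> []" using p(2) p' by auto
    \<comment> \<open>Following \<open>p\<close> and then \<open>q\<close> backwards returns to
      \<open>s\<close>. Counting \<open>v\<close> and \<open>s\<close> once each leaves
      \<open>length p + length q - 2\<close> vertices, an odd number.\<close>
    have "cwalk E (p' @ rev q')"
    proof (cases "q' = []")
      case True
      then have "v = s" using q q' by (simp add: W_def)
      then show ?thesis using p p' p'ne True by (auto simp: W_def cwalk_def successively_append_iff)
    next
      case False
      have "E s (hd q')" "successively E q'" "last q' = v"
        using q(1) q' False by (auto simp: W_def successively_Cons)
      moreover from this have "successively E (rev q')"
        by (simp, elim successively_mono) (simp add: E_sym)
      moreover have "hd p' = s" "E (last p') v" "successively E p'"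
        using p(1) p' p'ne by (auto simp: W_def successively_append_iff)
      ultimately show ?thesis
        using p'ne False E_sym[of s "hd q'"]
        by (auto simp: cwalk_def successively_append_iff hd_rev last_rev)
    qed
    moreover have "odd (length (p' @ rev q'))" using p(2) q(2) p' q' by auto
    ultimately show False using no by blast
  qed
  ultimately obtain u v where uv: "E u v" "\<not> (u \<in> A \<and> v \<in> B \<or> u \<in> B \<and> v \<in> A)"
    using nonbip by blast
  have "W v (p @ [v])" if "W u p" for p
    using that uv(1) by (auto simp: W_def successively_append_iff)
  then have "u \<in> A \<Longrightarrow> v \<in> B" "u \<in> B \<Longrightarrow> v \<in> A"
    using edge_in'[OF uv(1)] unfolding A_def B_def by fastforce+
  then show False using uv edge_in[OF uv(1)] \<open>A \<union> B = V\<close> by blast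
qed

lemma ex_consecutive_odd_cycles:
  assumes "\<And>A B. A \<union> B = V \<Longrightarrow> A \<inter> B = {} \<Longrightarrow>
      \<exists>u v. E u v \<and> \<not> (u \<in> A \<and> v \<in> B \<or> u \<in> B \<and> v \<in> A)"
  shows "consecutive_odd_cycles E"
proof -
  obtain C where C: "min_odd_cwalk E C"
    using ex_odd_cwalk[OF assms] cwalk_imp_min_odd_cwalk by metis
  show ?thesis
  proof (cases "length C = 3")
    case True
    then obtain a b c where "C = [a, b, c]"
      by (auto simp: numeral_3_eq_3 length_Suc_conv)
    then have "E a b" "E b c" "E c a" using C by (auto simp: min_odd_cwalk_def cwalk_def)
    then show ?thesis by (rule consecutive_odd_cycles_triangle)
  next
    case False
    moreover have "odd (length C)" using C by (simp add: min_odd_cwalk_def)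
    moreover have "3 \<le> length C" using C irr by (rule min_odd_cwalk_length)
    ultimately have "length C \<noteq> 4" "3 < length C" by auto
    then have "5 \<le> length C" by linarith
    then show ?thesis by (rule consecutive_odd_cycles_long[OF C])
  qed
qed

end

section \<open>Transfer to the library representation\<close>

text \<open>Library walks are lists of arcs; \<open>zip ys (tl ys)\<close> is the arc list of the
  vertex list \<open>ys\<close>.\<close>

lemma pcas_zip_tl:
  "ys \<noteq> [] \<Longrightarrow> pcas (hd ys) (zip ys (tl ys)) (last ys)"
  "ys \<noteq> [] \<Longrightarrow> pawalk_verts (hd ys) (zip ys (tl ys)) = ys"
  "successively (\<lambda>u v. (u, v) \<in> R) ys \<Longrightarrow> set (zip ys (tl ys)) \<subseteq> R"
proof (induction ys)
  case (Cons y ys)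
  { case 1 then show ?case using Cons.IH(1) by (cases ys) auto }
  { case 2 then show ?case using Cons.IH(2) by (cases ys) auto }
  { case 3 then show ?case using Cons.IH(3) by (cases ys) auto }
qed auto

lemma has_cycle_of_length_ucycle:
  assumes "pair_graph G" "ucycle (\<lambda>u v. (u, v) \<in> parcs G) xs"
  shows "has_cycle_of_length (with_proj G) (length xs)"
proof -
  interpret pair_graph G by fact
  have xs: "3 \<le> length xs" "distinct xs" "xs \<noteq> []" "successively (\<lambda>u v. (u, v) \<in> parcs G) xs"
    "(last xs, hd xs) \<in> parcs G"
    using assms(2) by (auto simp: ucycle_def cwalk_def)
  \<comment> \<open>Repeating the first vertex includes the closing arc, so there are as many arcs
    as vertices in \<open>xs\<close>.\<close>
  define ys where "ys = xs @ [hd xs]"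
  define p where "p = zip ys (tl ys)"
  have ys: "ys \<noteq> []" "hd ys = hd xs" "last ys = hd xs"
    using xs by (auto simp: ys_def)
  have "successively (\<lambda>u v. (u, v) \<in> parcs G) ys"
    using xs by (simp add: ys_def successively_append_iff)
  then have arcs: "set p \<subseteq> parcs G" unfolding p_def by (rule pcas_zip_tl)
  have len: "length p = length xs" by (simp add: p_def ys_def)
  have "pre_digraph.awalk (with_proj G) (hd xs) p (hd xs)"
    using arcs pcas_zip_tl(1)[OF ys(1)] ys xs(5) in_arcsD2 unfolding p_def
    by (auto simp: pre_digraph.awalk_def cas_with_proj_eq)
  moreover have "distinct (tl (pawalk_verts (hd xs) p))"
    using pcas_zip_tl(2)[OF ys(1)] ys(2) xs by (cases xs) (auto simp: p_def ys_def)
  ultimately have "pre_digraph.cycle (with_proj G) p"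
    using len xs by (auto simp: pre_digraph.cycle_def awalk_verts_with_proj_eq)
  then show ?thesis using len xs(1) by (auto simp: has_cycle_of_length_def)
qed

text \<open>A boundary with fewer than three vertices would be a separator, contradicting
  \<open>vertex_connected\<close>.\<close>

lemma three_connected_graphI:
  assumes "pair_graph G" "vertex_connected 3 (with_proj G)" "min_degree (with_proj G) \<ge> 4"
  shows "three_connected_graph (pverts G) (\<lambda>u v. (u, v) \<in> parcs G)"
proof -
  interpret pair_graph G by fact
  let ?E = "\<lambda>u v. (u, v) \<in> parcs G"
  show ?thesis
  proof
    show "finite (pverts G)" by (rule pair_finite_verts)
    show "symp ?E" using pair_sym_arcs by (auto simp: symp_def symmetric_def sym_def)
    show "irreflp ?E" using pair_no_loops by (fastforce simp: irreflp_def)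
    show "u \<in> pverts G" if "?E u v" for u v using that by (rule in_arcsD1)
  next
    fix v assume v: "v \<in> pverts G"
    have "out_arcs (with_proj G) v = (\<lambda>u. (v, u)) ` {u \<in> pverts G. ?E v u}"
      using in_arcsD2 by (auto simp: out_arcs_def)
    then have "out_degree (with_proj G) v = card {u \<in> pverts G. ?E v u}"
      by (simp add: out_degree_def card_image inj_on_def)
    moreover have "min_degree (with_proj G) \<le> out_degree (with_proj G) v"
      unfolding min_degree_def using v pair_finite_verts by (intro Min_le) auto
    ultimately show "4 \<le> card {u \<in> pverts G. ?E v u}" using assms(3) by simp
  next
    fix K assume K: "K \<subseteq> pverts G" "K \<noteq> {}" "pverts G - K - boundary (pverts G) ?E K \<noteq> {}"
    let ?S = "boundary (pverts G) ?E K"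
    show "3 \<le> card ?S"
    proof (rule ccontr)
      assume "\<not> 3 \<le> card ?S"
      moreover have "?S \<subseteq> pverts G" by (auto simp: boundary_def)
      ultimately have "Digraph_Component.connected (with_proj G \<restriction> (pverts G - ?S))"
        using assms(2) by (auto simp: vertex_connected_def)
      moreover obtain k w where k: "k \<in> K" and w: "w \<in> pverts G - K - ?S" using K by blast
      moreover have "k \<in> pverts G - ?S" using k K(1) by (auto simp: boundary_def)
      ultimately have "k \<rightarrow>\<^sup>*\<^bsub>with_proj (mk_symmetric (with_proj G \<restriction> (pverts G - ?S)))\<^esub> w"
        unfolding Digraph_Component.connected_def strongly_connected_def
        by (auto simp: induce_subgraph_def)
      \<comment> \<open>An edge leaving \<open>K\<close> ends in the deleted boundary, so a walk
        from \<open>k\<close> stays in \<open>K\<close>.\<close>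
      then have "w \<in> K" unfolding reachable_def
      proof (induction rule: rtrancl_on_induct)
        case base
        show ?case by (rule k)
      next
        case (step y z)
        have "?E y z" "z \<in> pverts G - ?S"
          using step pair_sym_arcs
          by (auto simp: parcs_mk_symmetric induce_subgraph_def symmetric_def sym_def)
        then show ?case using step.IH by (auto simp: boundary_def)
      qed
      then show False using w by blast
    qed
  qed
qed

theorem theorem1p5:
  fixes G :: "'a pair_pre_digraph"
  assumes "pair_graph G"
    and "vertex_connected 3 (with_proj G)"
    and "\<not> bipartite_graph (with_proj G)"
    and "min_degree (with_proj G) \<ge> 4"
  shows "\<exists>l::nat. odd l \<and> has_cycle_of_length (with_proj G) l \<and>
           has_cycle_of_length (with_proj G) (l + 2)"
proof -
  let ?E = "\<lambda>u v. (u, v) \<in> parcs G"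
  have "\<exists>u v. ?E u v \<and> \<not> (u \<in> A \<and> v \<in> B \<or> u \<in> B \<and> v \<in> A)"
    if "A \<union> B = pverts G" "A \<inter> B = {}" for A B
  proof (rule ccontr)
    assume "\<not> ?thesis"
    then have "\<forall>(u, v) \<in> arcs_ends (with_proj G). u \<in> A \<and> v \<in> B \<or> u \<in> B \<and> v \<in> A"
      by (simp only: with_proj_simps) blast
    moreover have "A \<union> B = verts (with_proj G)" using that by simp
    ultimately show False using assms(3) that(2) unfolding bipartite_graph_def by blast
  qed
  then have "consecutive_odd_cycles ?E"
    by (rule three_connected_graph.ex_consecutive_odd_cycles
        [OF three_connected_graphI[OF assms(1,2,4)]])
  then obtain xs ys where "ucycle ?E xs" "ucycle ?E ys" "odd (length xs)"
    "length ys = length xs + 2"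
    by (auto simp: consecutive_odd_cycles_def)
  then show ?thesis
    using has_cycle_of_length_ucycle[OF assms(1)] by metis
qed

end
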